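(* Let $C_n$ denote the $n$-chain $\{0,1,\ldots,n-1\}$ under the usual ordering. In the category of posets and weakly increasing functions, the product $C_n \times C_n$ has undefined alternation diameter.
   Context: A weakly increasing function between posets $(A,\leq_A)$ and $(B,\leq_B)$ is $f : A \to B$ such that $a \leq_A b \implies f(a) \leq_B f(b)$. Products in this category are Cartesian products with componentwise comparison. For a product $A \times B$ with projections $\pi_A, \pi_B$, let $G = \mathrm{Aut}(A \times B)$, $G_L = \{ g \in G : \pi_B \circ g = \pi_B \}$ and $G_R = \{ g \in G : \pi_A \circ g = \pi_A \}$; these are subgroups of $G$. The alternation diameter of $A \times B$ is undefined if $G$ is not generated by $G_L \cup G_R$.
   Formalization: The formal theorem assumes n ≥ 2; for n = 0 and n = 1 the automorphism group of C_n × C_n is trivial, hence generated by G_L ∪ G_R, so the claim as written fails in those cases. *)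

theory Defs
  imports "HOL-Algebra.Algebra"
begin

text \<open>
  Posets are records satisfying the locale \<^locale>\<open>partial_order\<close>; weakly increasing
  functions are those satisfying \<^const>\<open>isotone\<close>, which only constrains
  values on the carrier.
\<close>

definition chain :: "nat \<Rightarrow> nat gorder" where
  "chain n = \<lparr>carrier = {0..<n}, eq = (=), le = (\<le>)\<rparr>"

definition prod_poset :: "'a gorder \<Rightarrow> 'b gorder \<Rightarrow> ('a \<times> 'b) gorder" where
  "prod_poset A B =
    \<lparr>carrier = carrier A \<times> carrier B,
     eq = (=),
     le = (\<lambda>p q. fst p \<sqsubseteq>\<^bsub>A\<^esub> fst q \<and> snd p \<sqsubseteq>\<^bsub>B\<^esub> snd q)\<rparr>"

text \<open>
  Elements of \<^term>\<open>Bij S\<close> are extensional, so that an automorphism is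
  represented by exactly one function. As not every bijective weakly increasing function
  is an isomorphism of posets, the inverse is required to be weakly increasing, too.
\<close>

definition poset_auto :: "'a gorder \<Rightarrow> ('a \<Rightarrow> 'a) set" where
  "poset_auto P =
    {g \<in> Bij (carrier P). isotone P P g \<and> isotone P P (inv_into (carrier P) g)}"

definition PosetAutoGroup :: "'a gorder \<Rightarrow> ('a \<Rightarrow> 'a) monoid" where
  "PosetAutoGroup P = BijGroup (carrier P) \<lparr>carrier := poset_auto P\<rparr>"

definition left_autos :: "'a gorder \<Rightarrow> 'b gorder \<Rightarrow> ('a \<times> 'b \<Rightarrow> 'a \<times> 'b) set" where
  "left_autos A B = {g \<in> carrier (PosetAutoGroup (prod_poset A B)).
     \<forall>p \<in> carrier (prod_poset A B). snd (g p) = snd p}"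

definition right_autos :: "'a gorder \<Rightarrow> 'b gorder \<Rightarrow> ('a \<times> 'b \<Rightarrow> 'a \<times> 'b) set" where
  "right_autos A B = {g \<in> carrier (PosetAutoGroup (prod_poset A B)).
     \<forall>p \<in> carrier (prod_poset A B). fst (g p) = fst p}"

definition alternation_diameter_undefined :: "'a gorder \<Rightarrow> 'b gorder \<Rightarrow> bool" where
  "alternation_diameter_undefined A B \<longleftrightarrow>
     generate (PosetAutoGroup (prod_poset A B)) (left_autos A B \<union> right_autos A B)
       \<noteq> carrier (PosetAutoGroup (prod_poset A B))"

lemma partial_order_chain: "partial_order (chain n)"
  by unfold_locales (auto simp: chain_def)

lemma partial_order_prod_poset:
  assumes "partial_order A" "partial_order B"
  shows "partial_order (prod_poset A B)"
proof -
  interpret A: partial_order A by fact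
  interpret B: partial_order B by fact
  show ?thesis
    by unfold_locales
      (auto simp: prod_poset_def dest: A.le_antisym B.le_antisym A.le_trans B.le_trans)
qed

lemma poset_auto_iff:
  assumes "partial_order P"
  shows "g \<in> poset_auto P \<longleftrightarrow>
    g \<in> Bij (carrier P) \<and>
    (\<forall>x\<in>carrier P. \<forall>y\<in>carrier P. g x \<sqsubseteq>\<^bsub>P\<^esub> g y \<longleftrightarrow> x \<sqsubseteq>\<^bsub>P\<^esub> y)"
proof (cases "g \<in> Bij (carrier P)")
  case True
  let ?S = "carrier P"
  interpret partial_order P by fact
  have wpo: "weak_partial_order P" by unfold_locales
  have inj: "inj_on g ?S" and im: "g ` ?S = ?S"
    using True by (simp_all add: Bij_def bij_betw_def)
  have "isotone P P (inv_into ?S g) \<longleftrightarrow>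
      (\<forall>x\<in>g ` ?S. \<forall>y\<in>g ` ?S. x \<sqsubseteq>\<^bsub>P\<^esub> y \<longrightarrow> inv_into ?S g x \<sqsubseteq>\<^bsub>P\<^esub> inv_into ?S g y)"
    using wpo by (simp add: isotone_def im)
  also have "\<dots> \<longleftrightarrow> (\<forall>x\<in>?S. \<forall>y\<in>?S. g x \<sqsubseteq>\<^bsub>P\<^esub> g y \<longrightarrow> x \<sqsubseteq>\<^bsub>P\<^esub> y)"
    unfolding ball_simps using inj by (simp add: inv_into_f_f)
  finally show ?thesis
    using True wpo unfolding poset_auto_def isotone_def by blast
qed (simp add: poset_auto_def)

lemma subgroup_poset_auto:
  assumes P: "partial_order P"
  shows "subgroup (poset_auto P) (BijGroup (carrier P))"
proof (rule subgroup.intro)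
  let ?S = "carrier P"
  show "poset_auto P \<subseteq> carrier (BijGroup ?S)"
    by (auto simp: poset_auto_def BijGroup_def)
  show "x \<otimes>\<^bsub>BijGroup ?S\<^esub> y \<in> poset_auto P"
    if x: "x \<in> poset_auto P" and y: "y \<in> poset_auto P" for x y
  proof -
    have B: "x \<in> Bij ?S" "y \<in> Bij ?S" using x y by (simp_all add: poset_auto_def)
    have "y a \<in> ?S" if "a \<in> ?S" for a
      using Bij_imp_funcset[OF B(2)] that by blast
    then have "compose ?S x y \<in> poset_auto P"
      using x y compose_Bij[OF B] unfolding poset_auto_iff[OF P]
      by (simp add: compose_eq)
    then show ?thesis using B by (simp add: BijGroup_def)
  qed
  show "\<one>\<^bsub>BijGroup ?S\<^esub> \<in> poset_auto P"
    unfolding poset_auto_iff[OF P] by (simp add: BijGroup_def id_Bij)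
  show "inv\<^bsub>BijGroup ?S\<^esub> x \<in> poset_auto P" if x: "x \<in> poset_auto P" for x
  proof -
    have B: "x \<in> Bij ?S" using x by (simp add: poset_auto_def)
    then have im: "x ` ?S = ?S" by (simp add: Bij_def bij_betw_def)
    have "inv_into ?S x a \<sqsubseteq>\<^bsub>P\<^esub> inv_into ?S x b \<longleftrightarrow> a \<sqsubseteq>\<^bsub>P\<^esub> b"
      if a: "a \<in> ?S" and b: "b \<in> ?S" for a b
    proof -
      have "x (inv_into ?S x a) = a" "x (inv_into ?S x b) = b"
        using a b im by (simp_all add: f_inv_into_f)
      then show ?thesis
        using x Bij_inv_into_mem[OF B a] Bij_inv_into_mem[OF B b]
        unfolding poset_auto_iff[OF P] by metis
    qed
    then show ?thesis
      unfolding poset_auto_iff[OF P] inv_BijGroup[OF B]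
      using restrict_inv_into_Bij[OF B] by simp
  qed
qed

lemma group_PosetAutoGroup: "partial_order P \<Longrightarrow> group (PosetAutoGroup P)"
  unfolding PosetAutoGroup_def
  by (intro subgroup.subgroup_is_group subgroup_poset_auto group_BijGroup)

end

theory Submission
  imports Defs "HOL-Library.Product_Order"
begin

text \<open>
  Restricted to a row, an element of \<open>G\<^sub>L\<close> is an order embedding of a finite chain into
  itself, hence the identity; the same holds for \<open>G\<^sub>R\<close> and columns. So both
  subgroups are trivial, while the coordinate swap is a nontrivial automorphism.
\<close>

text \<open>Each unit step raises \<open>f\<close> by at least one: climbing from 0 gives
  \<open>x \<le> f x\<close>, and descending from the top element, whose image cannot exceed it,
  gives \<open>f x \<le> x\<close>.\<close>

lemma strict_mono_on_finite_chain_id: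
  fixes f :: "nat \<Rightarrow> nat"
  assumes mono: "strict_mono_on {0..<n} f" and into: "f ` {0..<n} \<subseteq> {0..<n}" and x: "x < n"
  shows "f x = x"
proof (rule antisym)
  show "x \<le> f x"
    using x
  proof (induction x)
    case (Suc x)
    then have "f x < f (Suc x)"
      by (intro strict_mono_onD[OF mono]) auto
    with Suc show ?case by simp
  qed simp
  \<comment> \<open>Since \<open>x < n\<close> makes \<open>n\<close> positive, \<open>n - 1\<close>
    is the top of the chain and serves as the start of the downward induction.\<close>
  have "x \<le> n - 1" using x by simp
  then show "f x \<le> x"
  proof (induction x rule: inc_induct)
    case base
    have "f (n - 1) \<in> {0..<n}" using x by (intro subsetD[OF into imageI]) simp
    then show ?case by auto
  next
    case (step m)
    then have "f m < f (Suc m)"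
      by (intro strict_mono_onD[OF mono]) auto
    with step show ?case by simp
  qed
qed

lemma partial_order_prod_chain: "partial_order (prod_poset (chain m) (chain n))"
  by (intro partial_order_prod_poset partial_order_chain)

text \<open>The order of \<open>Product_Order\<close> is componentwise, so on pairs of naturals it
  agrees with that of \<open>prod_poset\<close>; later arguments can then use the type class
  order.\<close>

lemma poset_auto_prod_chain_iff:
  "g \<in> poset_auto (prod_poset (chain m) (chain n)) \<longleftrightarrow>
    g \<in> Bij ({0..<m} \<times> {0..<n}) \<and>
    (\<forall>p \<in> {0..<m} \<times> {0..<n}. \<forall>q \<in> {0..<m} \<times> {0..<n}. g p \<le> g q \<longleftrightarrow> p \<le> q)"
  unfolding poset_auto_iff[OF partial_order_prod_chain]
  by (simp add: prod_poset_def chain_def less_eq_prod_def)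

lemma one_PosetAutoGroup_prod_chain:
  "\<one>\<^bsub>PosetAutoGroup (prod_poset (chain m) (chain n))\<^esub> = (\<lambda>p\<in>{0..<m} \<times> {0..<n}. p)"
  by (simp add: PosetAutoGroup_def BijGroup_def prod_poset_def chain_def)

lemma left_autos_chain_trivial:
  "left_autos (chain m) (chain n) \<subseteq> {\<one>\<^bsub>PosetAutoGroup (prod_poset (chain m) (chain n))\<^esub>}"
proof
  fix g
  assume "g \<in> left_autos (chain m) (chain n)"
  then have auto: "g \<in> poset_auto (prod_poset (chain m) (chain n))"
    and snd: "\<And>a b. a < m \<Longrightarrow> b < n \<Longrightarrow> snd (g (a, b)) = b"
    by (auto simp: left_autos_def PosetAutoGroup_def prod_poset_def chain_def)
  then have Bij: "g \<in> Bij ({0..<m} \<times> {0..<n})"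
    and le: "\<And>a b a' b'. a < m \<Longrightarrow> b < n \<Longrightarrow> a' < m \<Longrightarrow> b' < n \<Longrightarrow>
      g (a, b) \<le> g (a', b') \<longleftrightarrow> (a, b) \<le> (a', b')"
    by (auto simp: poset_auto_prod_chain_iff)
  have "fst (g (a, b)) = a" if "a < m" "b < n" for a b
  proof (rule strict_mono_on_finite_chain_id[of m "\<lambda>a. fst (g (a, b))"])
    show "strict_mono_on {0..<m} (\<lambda>a. fst (g (a, b)))"
    proof (rule strict_mono_onI)
      fix c d assume "c \<in> {0..<m}" "d \<in> {0..<m}" "c < d"
      then show "fst (g (c, b)) < fst (g (d, b))"
        \<comment> \<open>Both images have second coordinate \<open>b\<close>, so the failure of
          \<open><\<close> would give \<open>g (d, b) \<le> g (c, b)\<close>. As \<open>g\<close>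
          reflects the order, \<open>d \<le> c\<close> would follow.\<close>
        using le[of d b c b] snd[of c b] snd[of d b] \<open>b < n\<close>
        by (auto simp: less_eq_prod_def)
    qed
    show "(\<lambda>a. fst (g (a, b))) ` {0..<m} \<subseteq> {0..<m}"
      using Bij_imp_funcset[OF Bij] \<open>b < n\<close> by (fastforce simp: Pi_iff mem_Times_iff)
  qed fact
  then have "g = (\<lambda>p\<in>{0..<m} \<times> {0..<n}. p)"
    \<comment> \<open>Both functions are extensional, hence agree outside the product by convention;
      equality on the product suffices.\<close>
    using snd Bij_imp_extensional[OF Bij]
    by (intro extensionalityI[of _ "{0..<m} \<times> {0..<n}"]) (auto intro: prod_eqI)
  then show "g \<in> {\<one>\<^bsub>PosetAutoGroup (prod_poset (chain m) (chain n))\<^esub>}"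
    by (simp add: one_PosetAutoGroup_prod_chain)
qed

text \<open>The argument for \<open>left_autos\<close> with the coordinates exchanged:
  \<open>g\<close> maps each column into itself and is strictly increasing there.\<close>

lemma right_autos_chain_trivial:
  "right_autos (chain m) (chain n) \<subseteq> {\<one>\<^bsub>PosetAutoGroup (prod_poset (chain m) (chain n))\<^esub>}"
proof
  fix g
  assume "g \<in> right_autos (chain m) (chain n)"
  then have auto: "g \<in> poset_auto (prod_poset (chain m) (chain n))"
    and fst: "\<And>a b. a < m \<Longrightarrow> b < n \<Longrightarrow> fst (g (a, b)) = a"
    by (auto simp: right_autos_def PosetAutoGroup_def prod_poset_def chain_def)
  then have Bij: "g \<in> Bij ({0..<m} \<times> {0..<n})"
    and le: "\<And>a b a' b'. a < m \<Longrightarrow> b < n \<Longrightarrow> a' < m \<Longrightarrow> b' < n \<Longrightarrow>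
      g (a, b) \<le> g (a', b') \<longleftrightarrow> (a, b) \<le> (a', b')"
    by (auto simp: poset_auto_prod_chain_iff)
  have "snd (g (a, b)) = b" if "a < m" "b < n" for a b
  proof (rule strict_mono_on_finite_chain_id[of n "\<lambda>b. snd (g (a, b))"])
    show "strict_mono_on {0..<n} (\<lambda>b. snd (g (a, b)))"
    proof (rule strict_mono_onI)
      fix c d assume "c \<in> {0..<n}" "d \<in> {0..<n}" "c < d"
      then show "snd (g (a, c)) < snd (g (a, d))"
        using le[of a d a c] fst[of a c] fst[of a d] \<open>a < m\<close>
        by (auto simp: less_eq_prod_def)
    qed
    show "(\<lambda>b. snd (g (a, b))) ` {0..<n} \<subseteq> {0..<n}"
      using Bij_imp_funcset[OF Bij] \<open>a < m\<close> by (fastforce simp: Pi_iff mem_Times_iff)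
  qed fact
  then have "g = (\<lambda>p\<in>{0..<m} \<times> {0..<n}. p)"
    using fst Bij_imp_extensional[OF Bij]
    by (intro extensionalityI[of _ "{0..<m} \<times> {0..<n}"]) (auto intro: prod_eqI)
  then show "g \<in> {\<one>\<^bsub>PosetAutoGroup (prod_poset (chain m) (chain n))\<^esub>}"
    by (simp add: one_PosetAutoGroup_prod_chain)
qed

lemma swap_poset_auto:
  "restrict prod.swap ({0..<n} \<times> {0..<n}) \<in> poset_auto (prod_poset (chain n) (chain n))"
proof -
  have "bij_betw (restrict prod.swap ({0..<n} \<times> {0..<n})) ({0..<n} \<times> {0..<n}) ({0..<n} \<times> {0..<n})"
    \<comment> \<open>The swap is an involution, so it is its own inverse.\<close>
    by (rule bij_betw_byWitness[where f' = prod.swap]) auto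
  then show ?thesis
    by (auto simp: poset_auto_prod_chain_iff Bij_def less_eq_prod_def)
qed

theorem proposition1:
  fixes n :: nat
  assumes "n \<ge> 2"
  shows "alternation_diameter_undefined (chain n) (chain n)"
proof -
  let ?G = "PosetAutoGroup (prod_poset (chain n) (chain n))"
  let ?swap = "restrict prod.swap ({0..<n} \<times> {0..<n})"
  interpret group ?G
    by (intro group_PosetAutoGroup partial_order_prod_chain)
  have "generate ?G (left_autos (chain n) (chain n) \<union> right_autos (chain n) (chain n))
      \<subseteq> generate ?G {\<one>\<^bsub>?G\<^esub>}"
    using left_autos_chain_trivial right_autos_chain_trivial by (intro mono_generate) blast
  also have "\<dots> = {\<one>\<^bsub>?G\<^esub>}"
    by (rule generate_one)
  finally have trivial:
    "generate ?G (left_autos (chain n) (chain n) \<union> right_autos (chain n) (chain n)) \<subseteq> {\<one>\<^bsub>?G\<^esub>}" .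
  \<comment> \<open>Here \<open>n \<ge> 2\<close> enters: it puts the off-diagonal point
    \<open>(0, 1)\<close> in the carrier, where the swap moves it.\<close>
  have "?swap (0, 1) \<noteq> \<one>\<^bsub>?G\<^esub> (0, 1)"
    using assms by (simp add: one_PosetAutoGroup_prod_chain)
  then have "?swap \<noteq> \<one>\<^bsub>?G\<^esub>" by metis
  moreover have "?swap \<in> carrier ?G"
    using swap_poset_auto by (simp add: PosetAutoGroup_def)
  ultimately show ?thesis
    unfolding alternation_diameter_undefined_def using trivial by blast
qed

end
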